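(* Let $n\ge 1$ be such that $n/e$ is an integer, and let $t=n/e$. For every instance of $n$ items with pairwise distinct values, the $t$-Threshold Algorithm (with $t=n/e$), run on the items in uniformly random order, selects the item of largest value with probability $1-1/e$, and the expected number of items it selects is at most $1$. Hence it satisfies the expected capacity constraint of $1$ and has competitive ratio $1-1/e$ for the secretary problem under the expected capacity constraint.
   Context: Secretary problem with expected capacity constraint: there are $n$ items with real values $v(1),\dots,v(n)$ (each of weight $1$), presented one at a time in the order given by a uniformly random permutation $\pi$ of $\{1,\dots,n\}$. On each arrival an online algorithm must irrevocably decide whether to select the item, using only the values seen so far (and possibly internal randomness); selected items can never be removed, and the algorithm may keep selecting after it has already selected items. The expected capacity constraint of $1$ requires that for every instance, the expected number of selected items (over $\pi$ and the algorithm's randomness) is at most $1$. Let $i^\star$ be the item of largest value; the competitive ratio of an algorithm $A$ is $\min_{\text{instances}} \mathbb{P}_\pi(A \text{ selects } i^\star)$. The $t$-Threshold Algorithm: do not select any of the first $t$ arriving items; let $R$ be the largest value among them; for each subsequent arriving item $i$ (positions $t+1,\dots,n$), if $v(i)>R$ then select $i$ and set $R:=v(i)$, otherwise do not select $i$. *)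

theory Defs
  imports "HOL-Probability.Probability" "HOL-Combinatorics.Permutations"
begin

(* A randomized online algorithm in behavioural form: from the values seen so far (the current
   one last) and its own previous decisions it produces a random decision for the current item.
   Conditioning on the previous decisions allows correlated internal randomness. *)
type_synonym online_algorithm = "real list \<Rightarrow> bool list \<Rightarrow> bool pmf"

primrec decisions :: "online_algorithm \<Rightarrow> real list \<Rightarrow> nat \<Rightarrow> bool list pmf" where
  "decisions A xs 0 = return_pmf []"
| "decisions A xs (Suc k) =
     bind_pmf (decisions A xs k) (\<lambda>ds.
       map_pmf (\<lambda>d. ds @ [d]) (A (take (Suc k) xs) ds))"

(* The item arriving in position j is p j. *)
definition selection :: "online_algorithm \<Rightarrow> nat \<Rightarrow> (nat \<Rightarrow> real) \<Rightarrow> nat set pmf" where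
  "selection A n v =
     bind_pmf (pmf_of_set {p. p permutes {1..n}}) (\<lambda>p.
       map_pmf (\<lambda>ds. {p j |j. j \<in> {1..n} \<and> ds ! (j - 1)})
         (decisions A (map (\<lambda>j. v (p j)) [1..<Suc n]) n))"

definition instances :: "nat \<Rightarrow> (nat \<Rightarrow> real) set" where
  "instances n = {v. inj_on v {1..n}}"

definition best_item :: "nat \<Rightarrow> (nat \<Rightarrow> real) \<Rightarrow> nat" where
  "best_item n v = arg_max_on v {1..n}"

definition prob_selects_best :: "online_algorithm \<Rightarrow> nat \<Rightarrow> (nat \<Rightarrow> real) \<Rightarrow> real" where
  "prob_selects_best A n v = measure_pmf.prob (selection A n v) {S. best_item n v \<in> S}"

definition expected_selected :: "online_algorithm \<Rightarrow> nat \<Rightarrow> (nat \<Rightarrow> real) \<Rightarrow> real" where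
  "expected_selected A n v = measure_pmf.expectation (selection A n v) (\<lambda>S. real (card S))"

definition expected_capacity :: "online_algorithm \<Rightarrow> nat \<Rightarrow> real \<Rightarrow> bool" where
  "expected_capacity A n c \<longleftrightarrow> (\<forall>v\<in>instances n. expected_selected A n v \<le> c)"

definition competitive_ratio :: "online_algorithm \<Rightarrow> nat \<Rightarrow> real" where
  "competitive_ratio A n = (INF v\<in>instances n. prob_selects_best A n v)"

(* The value of R after the values xs (at least t of them) have arrived; the largest value
   among no items is -\<infinity>, hence ereal. *)
definition threshold_level :: "nat \<Rightarrow> real list \<Rightarrow> ereal" where
  "threshold_level t xs =
     foldl (\<lambda>R x. if ereal x > R then ereal x else R) (SUP x\<in>set (take t xs). ereal x) (drop t xs)"

definition threshold_algorithm :: "nat \<Rightarrow> online_algorithm" where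
  "threshold_algorithm t xs ds =
     return_pmf (length xs > t \<and> ereal (last xs) > threshold_level t (butlast xs))"

end

theory Submission
  imports Defs "HOL-Real_Asymp.Real_Asymp"
begin

text \<open>
  The threshold level always equals the running maximum, so the algorithm selects exactly the
  items arriving after position \<open>t\<close> that beat all their predecessors. By symmetry the position of
  the maximum over any set \<open>A\<close> of positions is uniform on \<open>A\<close>. With \<open>A\<close> the set of all positions,
  the best item arrives after position \<open>t\<close> with probability \<open>1 - t/n\<close>, and it is then selected; with
  \<open>A = {1..j}\<close>, the \<open>j\<close>-th arrival is a record with probability \<open>1/j\<close>, so the expected number of
  selections is the sum of \<open>1/j\<close> over \<open>t < j \<le> n\<close>, which is at most \<open>ln (n/t) \<le> 1\<close>.
\<close>

section \<open>The decisions of the algorithm in terms of records\<close>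

lemma threshold_level_eq_SUP: "threshold_level t xs = (SUP x\<in>set xs. ereal x)"
proof -
  \<comment> \<open>Each update of \<open>R\<close> is a binary supremum, so the fold accumulates
    onto an arbitrary start \<open>R\<close>. In \<open>ereal\<close> an empty supremum is minus
    infinity, the neutral element, which covers empty lists and \<open>t = 0\<close>.\<close>
  have foldl_max: "foldl (\<lambda>R x. if ereal x > R then ereal x else R) R ys
      = sup R (SUP x\<in>set ys. ereal x)" for R ys
  proof (induction ys arbitrary: R)
    case (Cons y ys)
    have "(if ereal y > R then ereal y else R) = sup R (ereal y)"
      by (auto simp: sup_max max_def)
    with Cons show ?case by (simp add: max.assoc)
  qed (simp add: bot_ereal_def)
  have "set xs = set (take t xs) \<union> set (drop t xs)"
    by (metis append_take_drop_id set_append)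
  then show ?thesis
    unfolding threshold_level_def foldl_max by (simp add: SUP_union)
qed

lemma SUP_ereal_less_iff:
  "finite A \<Longrightarrow> (SUP x\<in>A. ereal x) < ereal y \<longleftrightarrow> (\<forall>x\<in>A. x < y)"
  by (induction A rule: finite_induct) (auto simp: bot_ereal_def sup_max)

lemma decisions_threshold_algorithm:
  \<comment> \<open>The algorithm is deterministic, so every distribution collapses to a point mass.
    Indices are list indices: \<open>j\<close> stands for arrival number \<open>j + 1\<close>, hence
    \<open>t \<le> j\<close> says that the item comes after the first \<open>t\<close>.\<close>
  "k \<le> length xs \<Longrightarrow> decisions (threshold_algorithm t) xs k =
     return_pmf (map (\<lambda>j. t \<le> j \<and> (\<forall>i<j. xs ! i < xs ! j)) [0..<k])"
proof (induction k)
  case (Suc k)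
  have *: "take (Suc k) xs = take k xs @ [xs ! k]"
    using Suc.prems by (simp add: take_Suc_conv_app_nth)
  have "(\<forall>x\<in>set (take k xs). x < xs ! k) \<longleftrightarrow> (\<forall>i<k. xs ! i < xs ! k)"
    using Suc.prems by (subst nth_image[symmetric]) auto
  with Suc * show ?case
    by (simp add: bind_return_pmf threshold_algorithm_def threshold_level_eq_SUP
        SUP_ereal_less_iff less_Suc_eq_le)
qed simp

text \<open>This collects positions rather than items: for a fixed position, being a record is an
  event about the random permutation whose probability symmetry determines. The image under
  \<open>p\<close> turns positions back into items.\<close>

definition records_after :: "nat \<Rightarrow> nat \<Rightarrow> (nat \<Rightarrow> real) \<Rightarrow> (nat \<Rightarrow> nat) \<Rightarrow> nat set" where
  "records_after t n v p = {j \<in> {t<..n}. \<forall>i\<in>{1..<j}. v (p i) < v (p j)}"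

lemma selection_threshold_algorithm:
  "selection (threshold_algorithm t) n v =
     map_pmf (\<lambda>p. p ` records_after t n v p) (pmf_of_set {p. p permutes {1..n}})"
proof -
  have "{p j |j. j \<in> {1..n} \<and> map (\<lambda>j. t \<le> j \<and> (\<forall>i<j. map (\<lambda>j. v (p j)) [1..<Suc n] ! i
            < map (\<lambda>j. v (p j)) [1..<Suc n] ! j)) [0..<n] ! (j - 1)}
        = p ` records_after t n v p" for p
  proof -
    \<comment> \<open>Passes from zero-based list indices to positions counted from 1.\<close>
    have "(\<forall>i<j - 1. v (p (Suc i)) < v (p j)) \<longleftrightarrow> (\<forall>i\<in>{1..<j}. v (p i) < v (p j))" for j
    proof (intro iffI ballI)
      fix i assume "\<forall>i<j - 1. v (p (Suc i)) < v (p j)" "i \<in> {1..<j}"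
      moreover from this have "i - 1 < j - 1" "Suc (i - 1) = i" by auto
      ultimately show "v (p i) < v (p j)" by metis
    qed auto
    moreover have "t \<le> j - 1 \<longleftrightarrow> t < j" if "1 \<le> j" for j using that by linarith
    ultimately have "{j. j \<in> {1..n} \<and> map (\<lambda>j. t \<le> j \<and> (\<forall>i<j. map (\<lambda>j. v (p j)) [1..<Suc n] ! i
            < map (\<lambda>j. v (p j)) [1..<Suc n] ! j)) [0..<n] ! (j - 1)} = records_after t n v p"
      unfolding records_after_def by (auto simp del: upt_Suc)
    then show ?thesis by blast
  qed
  then show ?thesis
    unfolding selection_def map_pmf_def[of "\<lambda>p. p ` records_after t n v p"]
    by (simp add: decisions_threshold_algorithm del: upt_Suc One_nat_def)
qed

section \<open>Symmetry of a uniformly random permutation\<close>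

lemma inj_on_compose_permutes:
  "inj_on v S \<Longrightarrow> p permutes S \<Longrightarrow> inj_on (\<lambda>i. v (p i)) S"
  using comp_inj_on[of p S v] by (simp add: permutes_image permutes_inj_on comp_def)

lemma set_pmf_of_set_permutes:
  "finite S \<Longrightarrow> set_pmf (pmf_of_set {p. p permutes S}) = {p. p permutes S}"
  using permutes_id by (intro set_pmf_of_set finite_permutations) blast+

text \<open>Classify the permutations by the position in \<open>A\<close> that carries the largest
  value. Swapping two positions of \<open>A\<close> carries one class into the other, so all classes
  have equal size. As \<open>v\<close> is injective, they partition the permutations of
  \<open>S\<close>.\<close>

lemma card_permutes_max_at:
  fixes v :: "'a \<Rightarrow> real"
  assumes "finite S" "inj_on v S" "A \<subseteq> S" "k \<in> A"
  shows "card {p. p permutes S \<and> (\<forall>i\<in>A. v (p i) \<le> v (p k))} * card A = fact (card S)"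
proof -
  define B where "B k = {p. p permutes S \<and> (\<forall>i\<in>A. v (p i) \<le> v (p k))}" for k
  have fin: "finite {p. p permutes S}" using assms(1) by (rule finite_permutations)
  have finA: "finite A" using assms finite_subset by blast
  have finB: "finite (B l)" for l
    using fin by (rule finite_subset[rotated]) (auto simp: B_def)
  have B_le: "card (B l) \<le> card (B m)" if "l \<in> A" "m \<in> A" for l m
  proof (rule card_inj_on_le[where f = "\<lambda>p. p \<circ> Transposition.transpose l m"])
    show "inj_on (\<lambda>p. p \<circ> Transposition.transpose l m) (B l)"
      by (rule inj_onI) (metis comp_assoc comp_id transpose_comp_involutory)
    \<comment> \<open>The swap maps \<open>A\<close> to itself, so the comparisons still range over
      the same items.\<close>
    have "Transposition.transpose l m i \<in> A" if "i \<in> A" for i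
      using that \<open>l \<in> A\<close> \<open>m \<in> A\<close> by (auto simp: Transposition.transpose_def)
    moreover have "p \<circ> Transposition.transpose l m permutes S" if "p permutes S" for p
      using that \<open>l \<in> A\<close> \<open>m \<in> A\<close> assms(3)
      by (intro permutes_compose permutes_swap_id) auto
    ultimately show "(\<lambda>p. p \<circ> Transposition.transpose l m) ` B l \<subseteq> B m"
      by (auto simp: B_def)
  qed (rule finB)
  have "{p. p permutes S} = (\<Union>l\<in>A. B l)"
  proof (intro equalityI subsetI)
    fix p assume p: "p \<in> {p. p permutes S}"
    have "Max ((\<lambda>i. v (p i)) ` A) \<in> (\<lambda>i. v (p i)) ` A"
      using finA assms(4) by (intro Max_in) auto
    then obtain l where "l \<in> A" "v (p l) = Max ((\<lambda>i. v (p i)) ` A)" by force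
    with p finA show "p \<in> (\<Union>l\<in>A. B l)" by (auto simp: B_def intro!: bexI[of _ l])
  qed (auto simp: B_def)
  moreover have "B l \<inter> B m = {}" if "l \<in> A" "m \<in> A" "l \<noteq> m" for l m
  proof (rule ccontr)
    assume "B l \<inter> B m \<noteq> {}"
    then obtain p where p: "p permutes S" "v (p l) = v (p m)"
      using \<open>l \<in> A\<close> \<open>m \<in> A\<close> by (force simp: B_def)
    with that assms(3) show False
      using inj_on_compose_permutes[OF assms(2) p(1)] by (auto dest!: inj_onD)
  qed
  ultimately have "fact (card S) = (\<Sum>l\<in>A. card (B l))"
    using finA finB card_permutations[OF refl assms(1)] by (simp add: card_UN_disjoint)
  \<comment> \<open>\<open>B_le\<close> applied in both directions gives equal
    cardinalities.\<close>
  also have "\<dots> = (\<Sum>l\<in>A. card (B k))"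
    by (intro sum.cong refl antisym B_le assms(4))
  finally show ?thesis by (simp add: B_def mult.commute)
qed

text \<open>The bound telescopes from 1/(n+1) \<le> ln((n+1)/n), which is ln x \<le> x - 1 at x =
  n/(n+1).\<close>

lemma sum_inverse_le_ln:
  assumes "1 \<le> t" "t \<le> n"
  shows "(\<Sum>j\<in>{t<..n}. 1 / real j) \<le> ln (real n / real t)"
  using assms(2)
proof (induction n rule: dec_induct)
  case (step n)
  have "n > 0" using step assms by simp
  have "{t<..Suc n} = insert (Suc n) {t<..n}" using step by auto
  moreover have "1 / real (Suc n) \<le> ln (real (Suc n) / real n)"
  proof -
    have "ln (real n / real (Suc n)) \<le> real n / real (Suc n) - 1"
      using \<open>n > 0\<close> by (intro ln_le_minus_one) simp
    also have "\<dots> = - (1 / real (Suc n))" by (simp add: field_simps)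
    finally show ?thesis using \<open>n > 0\<close> by (simp add: ln_div)
  qed
  ultimately show ?case using step \<open>n > 0\<close> assms by (simp add: ln_div)
qed (use assms in simp)

section \<open>The best item among the records\<close>

lemma best_item_max:
  assumes "n \<ge> 1"
  shows "best_item n v \<in> {1..n}" "\<And>i. i \<in> {1..n} \<Longrightarrow> v i \<le> v (best_item n v)"
proof -
  \<comment> \<open>\<open>best_item\<close> is a Hilbert choice, so its properties become available
    only once some maximiser is exhibited.\<close>
  have "Max (v ` {1..n}) \<in> v ` {1..n}" using assms by (intro Max_in) auto
  then obtain m where "m \<in> {1..n}" "v m = Max (v ` {1..n})" by force
  then have "is_arg_max v (\<lambda>i. i \<in> {1..n}) m" by (auto simp: is_arg_max_linorder)
  then have "is_arg_max v (\<lambda>i. i \<in> {1..n}) (best_item n v)"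
    unfolding best_item_def arg_max_on_def arg_max_def by (rule someI)
  then show "best_item n v \<in> {1..n}" "\<And>i. i \<in> {1..n} \<Longrightarrow> v i \<le> v (best_item n v)"
    by (auto simp: is_arg_max_linorder)
qed

text \<open>Distinct values let the strict comparison with predecessors become a weak one that
  includes \<open>j\<close> itself, the form of the symmetry count with
  \<open>A = {1..j}\<close>.\<close>

lemma mem_records_after_iff:
  assumes "inj_on v {1..n}" "p permutes {1..n}" "j \<in> {t<..n}"
  shows "j \<in> records_after t n v p \<longleftrightarrow> (\<forall>i\<in>{1..j}. v (p i) \<le> v (p j))"
proof -
  have "v (p i) \<noteq> v (p j)" if "i \<in> {1..<j}" for i
    using that assms(3) inj_on_compose_permutes[OF assms(1,2)] by (auto dest!: inj_onD)
  moreover have "{1..j} = insert j {1..<j}" using assms(3) by auto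
  ultimately show ?thesis using assms(3) by (force simp: records_after_def less_le)
qed

text \<open>The best item beats all its predecessors wherever it arrives, so only its arrival after
  position \<open>t\<close> matters.\<close>

lemma best_item_mem_records_iff:
  assumes "n \<ge> 1" "inj_on v {1..n}" "p permutes {1..n}"
  shows "best_item n v \<in> p ` records_after t n v p \<longleftrightarrow>
    (\<exists>j\<in>{t<..n}. \<forall>i\<in>{1..n}. v (p i) \<le> v (p j))"
proof
  assume "best_item n v \<in> p ` records_after t n v p"
  then obtain j where "best_item n v = p j" "j \<in> {t<..n}"
    by (auto simp: records_after_def)
  then show "\<exists>j\<in>{t<..n}. \<forall>i\<in>{1..n}. v (p i) \<le> v (p j)"
    using best_item_max(2)[OF assms(1), of _ v] permutes_in_image[OF assms(3)] by metis
next
  assume "\<exists>j\<in>{t<..n}. \<forall>i\<in>{1..n}. v (p i) \<le> v (p j)"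
  then obtain j where j: "j \<in> {t<..n}" "\<forall>i\<in>{1..n}. v (p i) \<le> v (p j)" by blast
  have pj: "p j \<in> {1..n}"
    using j(1) by (intro iffD2[OF permutes_in_image[OF assms(3)]]) auto
  obtain i where i: "i \<in> {1..n}" "p i = best_item n v"
    using best_item_max(1)[OF assms(1)] permutes_image[OF assms(3)] by (metis imageE)
  then have "v (p j) = v (best_item n v)"
    using j(2) best_item_max(2)[OF assms(1) pj, of v] by (metis antisym)
  then have "p j = best_item n v"
    using assms(2) pj best_item_max(1)[OF assms(1)] by (auto dest: inj_onD)
  moreover have "j \<in> records_after t n v p"
    using j by (subst mem_records_after_iff[OF assms(2,3)]) auto
  ultimately show "best_item n v \<in> p ` records_after t n v p" by force
qed

section \<open>Success probability and expected number of selections\<close>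

lemma prob_max_at:
  fixes v :: "nat \<Rightarrow> real"
  assumes "inj_on v {1..n}" "A \<subseteq> {1..n}" "k \<in> A"
  shows "measure_pmf.prob (pmf_of_set {p. p permutes {1..n}})
    {p. \<forall>i\<in>A. v (p i) \<le> v (p k)} = 1 / real (card A)"
proof -
  let ?B = "{p. p permutes {1..n} \<and> (\<forall>i\<in>A. v (p i) \<le> v (p k))}"
  have "real (card ?B) * real (card A) = fact n"
    using arg_cong[OF card_permutes_max_at[OF _ assms], of real] by simp
  moreover have "card A > 0"
    using assms finite_subset by (subst card_gt_0_iff) auto
  moreover have "{p. p permutes {1..n}} \<noteq> {}" using permutes_id by blast
  moreover have "{p. p permutes {1..n}} \<inter> {p. \<forall>i\<in>A. v (p i) \<le> v (p k)} = ?B" by blast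
  ultimately show ?thesis
    by (simp add: measure_pmf_of_set finite_permutations card_permutations field_simps)
qed

lemma prob_selects_best_threshold_algorithm:
  assumes "n \<ge> 1" "t \<le> n" "v \<in> instances n"
  shows "prob_selects_best (threshold_algorithm t) n v = 1 - real t / real n"
proof -
  let ?P = "pmf_of_set {p. p permutes {1..n}}"
  \<comment> \<open>Restricting to permutations makes these events disjoint, because distinct
    positions then carry distinct values. The restriction does not change probabilities, as the
    distribution lives on permutations.\<close>
  let ?M = "\<lambda>j. {p. p permutes {1..n} \<and> (\<forall>i\<in>{1..n}. v (p i) \<le> v (p j))}"
  have inj: "inj_on v {1..n}" using assms(3) by (simp add: instances_def)
  have M: "measure_pmf.prob ?P (?M j) = 1 / real n" if "j \<in> {t<..n}" for j
  proof -
    have "measure_pmf.prob ?P (?M j)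
        = measure_pmf.prob ?P {p. \<forall>i\<in>{1..n}. v (p i) \<le> v (p j)}"
      by (intro measure_eq_AE) (auto simp: AE_measure_pmf_iff set_pmf_of_set_permutes)
    then show ?thesis using prob_max_at[OF inj order_refl, of j] that by simp
  qed
  have "disjoint_family_on ?M {t<..n}"
    unfolding disjoint_family_on_def
  proof (intro ballI impI, rule ccontr)
    fix j k assume jk: "j \<in> {t<..n}" "k \<in> {t<..n}" "j \<noteq> k" "?M j \<inter> ?M k \<noteq> {}"
    then obtain p where p: "p \<in> ?M j" "p \<in> ?M k" by blast
    then have "v (p j) = v (p k)" using jk by (intro antisym) auto
    with jk show False
      using inj_on_compose_permutes[OF inj, of p] p by (auto dest!: inj_onD)
  qed
  then have "measure_pmf.prob ?P (\<Union>j\<in>{t<..n}. ?M j)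
      = (\<Sum>j\<in>{t<..n}. measure_pmf.prob ?P (?M j))"
    by (intro measure_pmf.finite_measure_finite_Union) auto
  also have "\<dots> = (\<Sum>j\<in>{t<..n}. 1 / real n)" by (intro sum.cong refl M)
  also have "\<dots> = 1 - real t / real n"
    using assms(1,2) by (simp add: of_nat_diff field_simps)
  also have "measure_pmf.prob ?P (\<Union>j\<in>{t<..n}. ?M j)
      = measure_pmf.prob ?P {p. best_item n v \<in> p ` records_after t n v p}"
    by (intro measure_eq_AE)
      (auto simp: AE_measure_pmf_iff set_pmf_of_set_permutes
        best_item_mem_records_iff[OF assms(1) inj])
  also have "\<dots> = prob_selects_best (threshold_algorithm t) n v"
    by (simp add: prob_selects_best_def selection_threshold_algorithm vimage_def)
  finally show ?thesis by simp
qed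

lemma expected_selected_threshold_algorithm:
  assumes "v \<in> instances n"
  shows "expected_selected (threshold_algorithm t) n v = (\<Sum>j\<in>{t<..n}. 1 / real j)"
proof -
  let ?P = "pmf_of_set {p. p permutes {1..n}}"
  let ?R = "\<lambda>j. {p. \<forall>i\<in>{1..j}. v (p i) \<le> v (p j)}"
  have inj: "inj_on v {1..n}" using assms by (simp add: instances_def)
  have fin: "finite (set_pmf ?P)" by (simp add: set_pmf_of_set_permutes finite_permutations)
  \<comment> \<open>Writing the count as a sum of record indicators allows linearity of expectation,
    so dependence between records is harmless.\<close>
  have "real (card (p ` records_after t n v p)) = (\<Sum>j\<in>{t<..n}. indicator (?R j) p)"
    if "p permutes {1..n}" for p
  proof -
    have "records_after t n v p = {j \<in> {t<..n}. p \<in> ?R j}"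
      using mem_records_after_iff[OF inj that] by (auto simp: records_after_def)
    moreover have "card (p ` records_after t n v p) = card (records_after t n v p)"
      using permutes_inj[OF that] by (intro card_image) (auto intro: inj_on_subset)
    ultimately show ?thesis
      by (simp add: indicator_def sum.If_cases Int_def del: greaterThanAtMost_iff)
  qed
  then have "expected_selected (threshold_algorithm t) n v
      = measure_pmf.expectation ?P (\<lambda>p. \<Sum>j\<in>{t<..n}. indicator (?R j) p)"
    unfolding expected_selected_def selection_threshold_algorithm integral_map_pmf
    by (intro integral_cong_AE) (auto simp: AE_measure_pmf_iff set_pmf_of_set_permutes)
  also have "\<dots> = (\<Sum>j\<in>{t<..n}. measure_pmf.prob ?P (?R j))"
    by (subst Bochner_Integration.integral_sum)
      (intro integrable_measure_pmf_finite[OF fin], simp)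
  also have "\<dots> = (\<Sum>j\<in>{t<..n}. 1 / real j)"
  proof (intro sum.cong refl)
    fix j assume "j \<in> {t<..n}"
    then show "measure_pmf.prob ?P (?R j) = 1 / real j"
      using prob_max_at[OF inj, of "{1..j}" j] by simp
  qed
  finally show ?thesis .
qed

section \<open>Capacity and competitive ratio at the threshold n/e\<close>

lemma competitive_ratio_eqI:
  assumes "\<And>v. v \<in> instances n \<Longrightarrow> prob_selects_best A n v = c"
  shows "competitive_ratio A n = c"
proof -
  \<comment> \<open>A witness that instances exist, so that the infimum is taken over the singleton
    \<open>{c}\<close> and not over the empty set.\<close>
  have "real \<in> instances n" by (auto simp: instances_def intro: inj_onI)
  then have "prob_selects_best A n ` instances n = {c}" using assms by force
  then show ?thesis by (simp add: competitive_ratio_def)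
qed

text \<open>Rounding n/e up is the direction that gives n/t \<le> e, so the logarithmic bound on the
  expected number of selections is at most 1.\<close>

lemma threshold_algorithm_ceiling:
  assumes "n \<ge> 1" "int t = \<lceil>real n / exp 1\<rceil>"
  shows "v \<in> instances n \<Longrightarrow>
      prob_selects_best (threshold_algorithm t) n v = 1 - real t / real n"
    and "v \<in> instances n \<Longrightarrow> expected_selected (threshold_algorithm t) n v \<le> 1"
    and "expected_capacity (threshold_algorithm t) n 1"
    and "competitive_ratio (threshold_algorithm t) n = 1 - real t / real n"
proof -
  have "real n / exp 1 > 0" using assms(1) by simp
  then have t_pos: "1 \<le> t" using assms(2) by linarith
  have "real n / exp 1 \<le> real n / 1"
    using assms(1) by (intro divide_left_mono) (auto simp: one_le_exp_iff)
  then have t_le: "t \<le> n" using assms(2) by linarith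
  have "real n / exp 1 \<le> real t" using assms(2) by linarith
  then have "real n / real t \<le> exp 1" using t_pos by (simp add: field_simps)
  then have "ln (real n / real t) \<le> 1"
    using t_pos assms(1) ln_le_cancel_iff[of "real n / real t" "exp 1"] by simp
  then have sum_le: "(\<Sum>j\<in>{t<..n}. 1 / real j) \<le> 1"
    using sum_inverse_le_ln[OF t_pos t_le] by linarith
  show prob: "prob_selects_best (threshold_algorithm t) n v = 1 - real t / real n"
    if "v \<in> instances n" for v
    using prob_selects_best_threshold_algorithm[OF assms(1) t_le that] .
  show capacity: "expected_selected (threshold_algorithm t) n v \<le> 1" if "v \<in> instances n" for v
    using sum_le by (simp add: expected_selected_threshold_algorithm[OF that])
  show "expected_capacity (threshold_algorithm t) n 1"
    using capacity by (simp add: expected_capacity_def)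
  show "competitive_ratio (threshold_algorithm t) n = 1 - real t / real n"
    using prob by (rule competitive_ratio_eqI)
qed

text \<open>Since e is irrational, n/e is never an integer for n \<ge> 1, so the first conjunct
  holds vacuously. The second gives the exact values for the rounded threshold, and the third
  recovers 1 - 1/e as n grows.\<close>

theorem theorem2:
  "(\<forall>n t :: nat. n \<ge> 1 \<and> real n / exp 1 \<in> \<int> \<and> real t = real n / exp 1 \<longrightarrow>
      (\<forall>v\<in>instances n.
         prob_selects_best (threshold_algorithm t) n v = 1 - 1 / exp 1 \<and>
         expected_selected (threshold_algorithm t) n v \<le> 1) \<and>
      expected_capacity (threshold_algorithm t) n 1 \<and>
      competitive_ratio (threshold_algorithm t) n = 1 - 1 / exp 1) \<and>
   (\<forall>n t :: nat. n \<ge> 1 \<and> int t = \<lceil>real n / exp 1\<rceil> \<longrightarrow>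
      (\<forall>v\<in>instances n.
         prob_selects_best (threshold_algorithm t) n v = 1 - real t / real n \<and>
         expected_selected (threshold_algorithm t) n v \<le> 1) \<and>
      expected_capacity (threshold_algorithm t) n 1 \<and>
      competitive_ratio (threshold_algorithm t) n = 1 - real t / real n) \<and>
   (\<lambda>n. competitive_ratio (threshold_algorithm (nat \<lceil>real n / exp 1\<rceil>)) n)
     \<longlonglongrightarrow> 1 - 1 / exp 1"
proof (intro conjI allI impI)
  fix n t :: nat
  assume *: "n \<ge> 1 \<and> real n / exp 1 \<in> \<int> \<and> real t = real n / exp 1"
  then have "int t = \<lceil>real n / exp 1\<rceil>" by (metis ceiling_of_nat)
  moreover have "real t / real n = 1 / exp 1" using * by simp
  ultimately show "\<forall>v\<in>instances n.
         prob_selects_best (threshold_algorithm t) n v = 1 - 1 / exp 1 \<and>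
         expected_selected (threshold_algorithm t) n v \<le> 1"
    and "expected_capacity (threshold_algorithm t) n 1"
    and "competitive_ratio (threshold_algorithm t) n = 1 - 1 / exp 1"
    using threshold_algorithm_ceiling[of n t] * by auto
next
  fix n t :: nat
  assume *: "n \<ge> 1 \<and> int t = \<lceil>real n / exp 1\<rceil>"
  then show "\<forall>v\<in>instances n.
         prob_selects_best (threshold_algorithm t) n v = 1 - real t / real n \<and>
         expected_selected (threshold_algorithm t) n v \<le> 1"
    and "expected_capacity (threshold_algorithm t) n 1"
    and "competitive_ratio (threshold_algorithm t) n = 1 - real t / real n"
    using threshold_algorithm_ceiling[of n t] by auto
next
  let ?t = "\<lambda>n::nat. nat \<lceil>real n / exp 1\<rceil>"
  have "competitive_ratio (threshold_algorithm (?t n)) n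
      = 1 - real_of_int \<lceil>real n / exp 1\<rceil> / real n" if "n \<ge> 1" for n
  proof -
    have "0 \<le> real n / exp 1" by simp
    then have "int (?t n) = \<lceil>real n / exp 1\<rceil>" by linarith
    then show ?thesis using threshold_algorithm_ceiling(4)[OF that] by (metis of_int_of_nat_eq)
  qed
  \<comment> \<open>The formula is established for n \<ge> 1, which suffices for the limit.\<close>
  then have "\<forall>\<^sub>F n in sequentially. 1 - real_of_int \<lceil>real n / exp 1\<rceil> / real n
      = competitive_ratio (threshold_algorithm (?t n)) n"
    by (intro eventually_mono[OF eventually_ge_at_top[of 1]]) simp
  \<comment> \<open>The ceiling exceeds n/e by less than 1, an error that vanishes after division by
    n.\<close>
  moreover have "(\<lambda>n. 1 - real_of_int \<lceil>real n / exp 1\<rceil> / real n) \<longlonglongrightarrow> 1 - 1 / exp 1"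
    unfolding inverse_eq_divide[symmetric] by real_asymp
  ultimately show "(\<lambda>n. competitive_ratio (threshold_algorithm (?t n)) n) \<longlonglongrightarrow> 1 - 1 / exp 1"
    by (rule Lim_transform_eventually[rotated])
qed

end
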